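(* Using a parallel mechanical matrix-vector processor (MVP), the Boolean product $AB$ of two Boolean $n\times n$ matrices $A$ and $B$ (with $(AB)[i,j]=\bigvee_{k=1}^n(A[i,k]\wedge B[k,j])$) can be computed in $O(n)$ parallel steps, each using $O(n)$ operations.
   Context: A matrix-vector processor (MVP) has an input $n\times n$ Boolean array whose columns can be active or not active, an input $n$-dimensional Boolean vector, and an output $n$-dimensional Boolean vector. A parallel mechanical MVP is one in which: deactivating all columns can be done in one parallel step and activating exactly the columns $j$ with input-vector coordinate $1$ can be done in one parallel step, each using $O(n)$ operations; setting all $n$ output coordinates (the $i$-th to $1$ iff row $i$ of the input array has a $1$ in an active column, else $0$) is done in one parallel step using $O(n)$ operations; resetting the output vector is one parallel step with $O(n)$ operations; reading an input vector is one parallel step with $O(n)$ operations; and reading an $n\times n$ input matrix into the input array takes $O(n)$ parallel steps each using $O(n)$ operations. *)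

theory Defs
  imports Complex_Main "HOL-Library.Landau_Symbols" "Jordan_Normal_Form.Matrix"
begin

definition bool_mat_mult :: "nat \<Rightarrow> bool mat \<Rightarrow> bool mat \<Rightarrow> bool mat" where
  "bool_mat_mult n A B = mat n n (\<lambda>(i, j). \<exists>k<n. A $$ (i, k) \<and> B $$ (k, j))"

record mvp_state =
  input_array :: "bool mat"
  active_columns :: "nat set"
  input_vector :: "bool vec"
  output_vector :: "bool vec"

definition mvp_states :: "nat \<Rightarrow> mvp_state set" where
  "mvp_states n = {s. input_array s \<in> carrier_mat n n \<and> active_columns s \<subseteq> {..<n} \<and>
     input_vector s \<in> carrier_vec n \<and> output_vector s \<in> carrier_vec n}"

text \<open>
  The type parameters are the vectors and matrices that can be read: actual Boolean data for the
  device itself, references to the operands for a program (see below).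
\<close>

datatype ('v, 'm) mvp_instr =
    Deactivate_Columns
  | Activate_Columns
  | Set_Output
  | Reset_Output
  | Read_Vector 'v
  | Read_Matrix 'm

type_synonym mvp_op = "(bool vec, bool mat) mvp_instr"

definition mvp_ops :: "nat \<Rightarrow> mvp_op set" where
  "mvp_ops n = {x. set1_mvp_instr x \<subseteq> carrier_vec n \<and> set2_mvp_instr x \<subseteq> carrier_mat n n}"

fun exec_op :: "nat \<Rightarrow> mvp_op \<Rightarrow> mvp_state \<Rightarrow> mvp_state" where
  "exec_op n Deactivate_Columns s = s\<lparr>active_columns := {}\<rparr>"
| "exec_op n Activate_Columns s = s\<lparr>active_columns := {j. j < n \<and> input_vector s $ j}\<rparr>"
| "exec_op n Set_Output s =
     s\<lparr>output_vector := vec n (\<lambda>i. \<exists>j\<in>active_columns s. input_array s $$ (i, j))\<rparr>"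
| "exec_op n Reset_Output s = s\<lparr>output_vector := vec n (\<lambda>i. False)\<rparr>"
| "exec_op n (Read_Vector v) s = s\<lparr>input_vector := v\<rparr>"
| "exec_op n (Read_Matrix M) s = s\<lparr>input_array := M\<rparr>"

definition run :: "nat \<Rightarrow> mvp_op list \<Rightarrow> mvp_state \<Rightarrow> mvp_state" where
  "run n xs s = fold (exec_op n) xs s"

text \<open>
  A cost assignment describes the physical realisation of a device: \<open>cost n s x\<close> lists, for the
  consecutive parallel steps in which the device of size \<open>n\<close> carries out \<open>x\<close> in state \<open>s\<close>, the number
  of operations used in each of these steps.
\<close>

type_synonym mvp_cost = "nat \<Rightarrow> mvp_state \<Rightarrow> mvp_op \<Rightarrow> nat list"

fun run_cost :: "mvp_cost \<Rightarrow> nat \<Rightarrow> mvp_op list \<Rightarrow> mvp_state \<Rightarrow> nat list" where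
  "run_cost cost n [] s = []"
| "run_cost cost n (x # xs) s = cost n s x @ run_cost cost n xs (exec_op n x s)"

definition parallel_mechanical_mvp :: "mvp_cost \<Rightarrow> bool" where
  "parallel_mechanical_mvp cost \<longleftrightarrow>
     (\<exists>r w :: nat \<Rightarrow> nat.
        (\<lambda>n. real (r n)) \<in> O(\<lambda>n. real n) \<and> (\<lambda>n. real (w n)) \<in> O(\<lambda>n. real n) \<and>
        (\<forall>n. \<forall>s\<in>mvp_states n. \<forall>x\<in>mvp_ops n.
           (case x of Read_Matrix M \<Rightarrow> length (cost n s x) \<le> r n
                    | _ \<Rightarrow> length (cost n s x) = 1) \<and>
           (\<forall>k\<in>set (cost n s x). k \<le> w n)))"

text \<open>
  Programs for matrix multiplication may depend on the size but not on the entries of the operands: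
  all they can do with the operands is to have one of them, or a row or column of one of them, read
  by the device.
\<close>

datatype operand = Left_Operand | Right_Operand

datatype vector_ref = Row_Of operand nat | Column_Of operand nat

type_synonym mvp_program = "(vector_ref, operand) mvp_instr list"

fun fetch_matrix :: "bool mat \<Rightarrow> bool mat \<Rightarrow> operand \<Rightarrow> bool mat" where
  "fetch_matrix A B Left_Operand = A"
| "fetch_matrix A B Right_Operand = B"

fun fetch_vector :: "bool mat \<Rightarrow> bool mat \<Rightarrow> vector_ref \<Rightarrow> bool vec" where
  "fetch_vector A B (Row_Of X i) = row (fetch_matrix A B X) i"
| "fetch_vector A B (Column_Of X j) = col (fetch_matrix A B X) j"

definition well_formed_program :: "nat \<Rightarrow> mvp_program \<Rightarrow> bool" where
  "well_formed_program n p \<longleftrightarrow>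
     (\<forall>x\<in>set p. \<forall>v\<in>set1_mvp_instr x. case v of Row_Of X i \<Rightarrow> i < n | Column_Of X j \<Rightarrow> j < n)"

definition instantiate :: "bool mat \<Rightarrow> bool mat \<Rightarrow> mvp_program \<Rightarrow> mvp_op list" where
  "instantiate A B p = map (map_mvp_instr (fetch_vector A B) (fetch_matrix A B)) p"

text \<open>
  The device has only one output vector, so a matrix is output column by column: column \<open>j\<close> of
  the result is the content of the output vector after the first \<open>t j\<close> instructions. Like the
  program, the readout times \<open>t\<close> must not depend on the operands.
\<close>

definition result_matrix ::
  "nat \<Rightarrow> (nat \<Rightarrow> nat) \<Rightarrow> mvp_op list \<Rightarrow> mvp_state \<Rightarrow> bool mat" where
  "result_matrix n t xs s =
     mat_of_cols n (map (\<lambda>j. output_vector (run n (take (t j) xs) s)) [0..<n])"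

end

theory Submission
  imports Defs
begin

text \<open>
  Column \<open>j\<close> of \<open>AB\<close> is the product of \<open>A\<close> with column \<open>j\<close> of \<open>B\<close>. Hence \<open>A\<close> is read into the array
  once, in \<open>O(n)\<close> parallel steps, and each of the \<open>n\<close> columns of \<open>B\<close> then costs only three further
  parallel steps: read it as the input vector, activate the columns it selects, set the output.
\<close>

definition bool_mat_mult_vec :: "nat \<Rightarrow> bool mat \<Rightarrow> bool vec \<Rightarrow> bool vec" where
  "bool_mat_mult_vec n A v = vec n (\<lambda>i. \<exists>k<n. A $$ (i, k) \<and> v $ k)"

lemma bool_mat_mult_carrier [simp]: "bool_mat_mult n A B \<in> carrier_mat n n"
  by (simp add: bool_mat_mult_def)

lemma col_bool_mat_mult:
  assumes "B \<in> carrier_mat n n" and "j < n"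
  shows "col (bool_mat_mult n A B) j = bool_mat_mult_vec n A (col B j)"
  using assms by (intro eq_vecI) (auto simp: bool_mat_mult_def bool_mat_mult_vec_def)

lemma exec_op_mvp_states:
  assumes "s \<in> mvp_states n" and "x \<in> mvp_ops n"
  shows "exec_op n x s \<in> mvp_states n"
  using assms by (cases x) (auto simp: mvp_states_def mvp_ops_def)

lemma run_mvp_states:
  assumes "s \<in> mvp_states n" and "set xs \<subseteq> mvp_ops n"
  shows "run n xs s \<in> mvp_states n"
  using assms by (induction xs arbitrary: s) (simp_all add: run_def exec_op_mvp_states)

lemma run_append: "run n (xs @ ys) s = run n ys (run n xs s)"
  by (simp add: run_def)

lemma result_matrix_eqI:
  assumes "M \<in> carrier_mat n n"
    and "\<And>j. j < n \<Longrightarrow> output_vector (run n (take (t j) xs) s) = col M j"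
  shows "result_matrix n t xs s = M"
proof -
  have "map (\<lambda>j. output_vector (run n (take (t j) xs) s)) [0..<n] = cols M"
    using assms by (simp add: cols_def)
  then show ?thesis
    using assms(1) mat_of_cols_cols[of M] by (simp add: result_matrix_def)
qed

lemma instantiate_append: "instantiate A B (p @ q) = instantiate A B p @ instantiate A B q"
  by (simp add: instantiate_def)

lemma take_instantiate: "take k (instantiate A B p) = instantiate A B (take k p)"
  by (simp add: instantiate_def take_map)

lemma fetch_matrix_carrier:
  assumes "A \<in> carrier_mat n n" and "B \<in> carrier_mat n n"
  shows "fetch_matrix A B X \<in> carrier_mat n n"
  using assms by (cases X) simp_all

lemma fetch_vector_carrier:
  assumes "A \<in> carrier_mat n n" and "B \<in> carrier_mat n n"
  shows "fetch_vector A B v \<in> carrier_vec n"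
proof -
  have "dim_row (fetch_matrix A B X) = n" and "dim_col (fetch_matrix A B X) = n" for X
    by (rule carrier_matD[OF fetch_matrix_carrier[OF assms]])+
  then show ?thesis
    by (cases v) (simp_all add: carrier_vecI)
qed

lemma instantiate_mvp_ops:
  assumes "A \<in> carrier_mat n n" and "B \<in> carrier_mat n n"
  shows "set (instantiate A B p) \<subseteq> mvp_ops n"
  using fetch_matrix_carrier[OF assms] fetch_vector_carrier[OF assms]
  by (auto simp: instantiate_def mvp_ops_def mvp_instr.set_map)

lemma run_cost_eq_concat:
  "run_cost cost n xs s =
    concat (map (\<lambda>i. cost n (run n (take i xs) s) (xs ! i)) [0..<length xs])"
  by (induction xs arbitrary: s) (simp_all add: run_def map_upt_Suc del: upt_Suc)

definition cost_bounded :: "mvp_cost \<Rightarrow> nat \<Rightarrow> (mvp_op \<Rightarrow> nat) \<Rightarrow> nat \<Rightarrow> bool" where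
  "cost_bounded cost n f w \<longleftrightarrow>
    (\<forall>s\<in>mvp_states n. \<forall>x\<in>mvp_ops n. length (cost n s x) \<le> f x \<and> (\<forall>k\<in>set (cost n s x). k \<le> w))"

lemma cost_bounded_run:
  assumes "cost_bounded cost n f w" and "s \<in> mvp_states n" and "set xs \<subseteq> mvp_ops n"
    and "i < length xs"
  shows "length (cost n (run n (take i xs) s) (xs ! i)) \<le> f (xs ! i)"
    and "\<forall>k\<in>set (cost n (run n (take i xs) s) (xs ! i)). k \<le> w"
proof -
  have "run n (take i xs) s \<in> mvp_states n"
    using assms(2,3) set_take_subset[of i xs] by (intro run_mvp_states) auto
  moreover have "xs ! i \<in> mvp_ops n"
    using assms(3,4) nth_mem by blast
  ultimately show "length (cost n (run n (take i xs) s) (xs ! i)) \<le> f (xs ! i)"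
    and "\<forall>k\<in>set (cost n (run n (take i xs) s) (xs ! i)). k \<le> w"
    using assms(1) by (simp_all add: cost_bounded_def)
qed

lemma length_run_cost_le:
  assumes "cost_bounded cost n f w" and "s \<in> mvp_states n" and "set xs \<subseteq> mvp_ops n"
  shows "length (run_cost cost n xs s) \<le> (\<Sum>x\<leftarrow>xs. f x)"
proof -
  have "length (run_cost cost n xs s) =
      (\<Sum>i\<leftarrow>[0..<length xs]. length (cost n (run n (take i xs) s) (xs ! i)))"
    by (simp add: run_cost_eq_concat length_concat o_def)
  also have "\<dots> \<le> (\<Sum>i\<leftarrow>[0..<length xs]. f (xs ! i))"
    using cost_bounded_run(1)[OF assms] by (intro sum_list_mono) simp
  also have "\<dots> = (\<Sum>x\<leftarrow>map ((!) xs) [0..<length xs]. f x)"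
    by (simp add: o_def)
  also have "\<dots> = (\<Sum>x\<leftarrow>xs. f x)"
    by (simp only: map_nth)
  finally show ?thesis .
qed

lemma set_run_cost_le:
  assumes "cost_bounded cost n f w" and "s \<in> mvp_states n" and "set xs \<subseteq> mvp_ops n"
    and "k \<in> set (run_cost cost n xs s)"
  shows "k \<le> w"
  using cost_bounded_run(2)[OF assms(1-3)] assms(4) by (auto simp: run_cost_eq_concat)

fun instr_steps :: "nat \<Rightarrow> ('v, 'm) mvp_instr \<Rightarrow> nat" where
  "instr_steps r (Read_Matrix M) = r"
| "instr_steps r _ = 1"

lemma instr_steps_map [simp]: "instr_steps r (map_mvp_instr f g x) = instr_steps r x"
  by (cases x) simp_all

lemma sum_list_instr_steps_instantiate:
  "(\<Sum>x\<leftarrow>instantiate A B p. instr_steps r x) = (\<Sum>x\<leftarrow>p. instr_steps r x)"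
  by (simp add: instantiate_def o_def)

lemma parallel_mechanical_mvpE:
  assumes "parallel_mechanical_mvp cost"
  obtains r w :: "nat \<Rightarrow> nat"
  where "(\<lambda>n. real (r n)) \<in> O(\<lambda>n. real n)" and "(\<lambda>n. real (w n)) \<in> O(\<lambda>n. real n)"
    and "\<And>n. cost_bounded cost n (instr_steps (r n)) (w n)"
proof -
  obtain r w :: "nat \<Rightarrow> nat"
    where linear: "(\<lambda>n. real (r n)) \<in> O(\<lambda>n. real n)" "(\<lambda>n. real (w n)) \<in> O(\<lambda>n. real n)"
      and bounds: "\<And>n s x. s \<in> mvp_states n \<Longrightarrow> x \<in> mvp_ops n \<Longrightarrow>
        (case x of Read_Matrix M \<Rightarrow> length (cost n s x) \<le> r n | _ \<Rightarrow> length (cost n s x) = 1) \<and>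
        (\<forall>k\<in>set (cost n s x). k \<le> w n)"
    using assms unfolding parallel_mechanical_mvp_def by blast
  have "length (cost n s x) \<le> instr_steps (r n) x"
    if "s \<in> mvp_states n" and "x \<in> mvp_ops n" for n s x
    using bounds[OF that] by (cases x) simp_all
  then have "cost_bounded cost n (instr_steps (r n)) (w n)" for n
    using bounds unfolding cost_bounded_def by blast
  with linear show thesis
    by (rule that)
qed

definition mult_vec_program :: "vector_ref \<Rightarrow> mvp_program" where
  "mult_vec_program v = [Read_Vector v, Activate_Columns, Set_Output]"

definition mult_vecs_program :: "operand \<Rightarrow> vector_ref list \<Rightarrow> mvp_program" where
  "mult_vecs_program X vs = Read_Matrix X # concat (map mult_vec_program vs)"

lemma length_mult_vec_program: "length (mult_vec_program v) = 3"
  by (simp add: mult_vec_program_def)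

lemma mult_vecs_program_append:
  "mult_vecs_program X (vs @ [v]) = mult_vecs_program X vs @ mult_vec_program v"
  by (simp add: mult_vecs_program_def)

lemma length_mult_vecs_program: "length (mult_vecs_program X vs) = 3 * length vs + 1"
  by (induction vs) (simp_all add: mult_vecs_program_def length_mult_vec_program)

lemma sum_list_instr_steps_mult_vecs_program:
  "(\<Sum>x\<leftarrow>mult_vecs_program X vs. instr_steps r x) = r + 3 * length vs"
  by (induction vs) (simp_all add: mult_vecs_program_def mult_vec_program_def)

lemma take_mult_vecs_program:
  "take (3 * k + 1) (mult_vecs_program X vs) = mult_vecs_program X (take k vs)"
proof -
  have "take (3 * k) (concat (map mult_vec_program vs)) = concat (map mult_vec_program (take k vs))"
  proof (induction vs arbitrary: k)
    case (Cons v vs)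
    then show ?case by (cases k) (simp_all add: length_mult_vec_program)
  qed simp
  then show ?thesis by (simp add: mult_vecs_program_def)
qed

lemma input_array_run_mult_vec_program:
  "input_array (run n (instantiate A B (mult_vec_program v)) s) = input_array s"
  by (simp add: run_def instantiate_def mult_vec_program_def)

lemma output_vector_run_mult_vec_program:
  "output_vector (run n (instantiate A B (mult_vec_program v)) s) =
    bool_mat_mult_vec n (input_array s) (fetch_vector A B v)"
  by (intro eq_vecI)
    (auto simp: run_def instantiate_def mult_vec_program_def bool_mat_mult_vec_def)

lemma input_array_run_mult_vecs_program:
  "input_array (run n (instantiate A B (mult_vecs_program X vs)) s) = fetch_matrix A B X"
proof (induction vs rule: rev_induct)
  case Nil
  show ?case by (simp add: run_def instantiate_def mult_vecs_program_def)
next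
  case (snoc v vs)
  then show ?case
    by (simp add: mult_vecs_program_append instantiate_append run_append
        input_array_run_mult_vec_program)
qed

lemma output_vector_run_mult_vecs_program:
  assumes "j < length vs"
  shows "output_vector (run n (take (3 * Suc j + 1) (instantiate A B (mult_vecs_program X vs))) s) =
    bool_mat_mult_vec n (fetch_matrix A B X) (fetch_vector A B (vs ! j))"
proof -
  have "take (3 * Suc j + 1) (instantiate A B (mult_vecs_program X vs)) =
      instantiate A B (mult_vecs_program X (take j vs)) @ instantiate A B (mult_vec_program (vs ! j))"
    by (simp only: take_instantiate take_mult_vecs_program take_Suc_conv_app_nth[OF assms]
        mult_vecs_program_append instantiate_append)
  then show ?thesis
    by (simp only: run_append output_vector_run_mult_vec_program input_array_run_mult_vecs_program)
qed

definition product_program :: "nat \<Rightarrow> mvp_program" where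
  "product_program n = mult_vecs_program Left_Operand (map (Column_Of Right_Operand) [0..<n])"

lemma well_formed_product_program: "well_formed_program n (product_program n)"
  by (auto simp: well_formed_program_def product_program_def mult_vecs_program_def
      mult_vec_program_def)

lemma length_product_program: "length (product_program n) = 3 * n + 1"
  by (simp add: product_program_def length_mult_vecs_program)

lemma result_matrix_product_program:
  assumes "B \<in> carrier_mat n n"
  shows "result_matrix n (\<lambda>j. 3 * Suc j + 1) (instantiate A B (product_program n)) s =
    bool_mat_mult n A B"
proof (rule result_matrix_eqI[OF bool_mat_mult_carrier])
  fix j
  assume "j < n"
  then show "output_vector (run n (take (3 * Suc j + 1) (instantiate A B (product_program n))) s) =
      col (bool_mat_mult n A B) j"
    unfolding product_program_def
    by (subst output_vector_run_mult_vecs_program) (simp_all add: col_bool_mat_mult[OF assms])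
qed

lemma length_run_cost_product_program_le:
  assumes "cost_bounded cost n (instr_steps r) w" and "s \<in> mvp_states n"
    and "A \<in> carrier_mat n n" and "B \<in> carrier_mat n n"
  shows "length (run_cost cost n (instantiate A B (product_program n)) s) \<le> r + 3 * n"
  using length_run_cost_le[OF assms(1,2) instantiate_mvp_ops[OF assms(3,4)], of "product_program n"]
  by (simp add: sum_list_instr_steps_instantiate product_program_def
      sum_list_instr_steps_mult_vecs_program)

theorem theorem2:
  fixes cost :: mvp_cost
  assumes "parallel_mechanical_mvp cost"
  shows "\<exists>(prog :: nat \<Rightarrow> mvp_program) (t :: nat \<Rightarrow> nat \<Rightarrow> nat) (T :: nat \<Rightarrow> nat) (W :: nat \<Rightarrow> nat).
    (\<lambda>n. real (T n)) \<in> O(\<lambda>n. real n) \<and> (\<lambda>n. real (W n)) \<in> O(\<lambda>n. real n) \<and>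
    (\<forall>n. well_formed_program n (prog n) \<and> (\<forall>j<n. t n j \<le> length (prog n)) \<and>
      (\<forall>A \<in> carrier_mat n n. \<forall>B \<in> carrier_mat n n. \<forall>s \<in> mvp_states n.
        result_matrix n (t n) (instantiate A B (prog n)) s = bool_mat_mult n A B \<and>
        length (run_cost cost n (instantiate A B (prog n)) s) \<le> T n \<and>
        (\<forall>k \<in> set (run_cost cost n (instantiate A B (prog n)) s). k \<le> W n)))"
proof -
  obtain r w :: "nat \<Rightarrow> nat"
    where reading_linear: "(\<lambda>n. real (r n)) \<in> O(\<lambda>n. real n)"
      and work_linear: "(\<lambda>n. real (w n)) \<in> O(\<lambda>n. real n)"
      and bounded: "\<And>n. cost_bounded cost n (instr_steps (r n)) (w n)"
    using parallel_mechanical_mvpE[OF assms] by blast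
  have steps_linear: "(\<lambda>n. real (r n + 3 * n)) \<in> O(\<lambda>n. real n)"
    using reading_linear by (simp add: sum_in_bigo)
  have readout_le: "3 * Suc j + 1 \<le> length (product_program n)" if "j < n" for j n
    using that by (simp add: length_product_program)
  show ?thesis
  proof (rule exI[of _ product_program], rule exI[of _ "\<lambda>n j. 3 * Suc j + 1"],
      rule exI[of _ "\<lambda>n. r n + 3 * n"], rule exI[of _ w], intro conjI allI ballI impI)
    fix n k and A B :: "bool mat" and s
    assume inputs: "A \<in> carrier_mat n n" "B \<in> carrier_mat n n" "s \<in> mvp_states n"
    show "length (run_cost cost n (instantiate A B (product_program n)) s) \<le> r n + 3 * n"
      by (rule length_run_cost_product_program_le[OF bounded inputs(3,1,2)])
    assume "k \<in> set (run_cost cost n (instantiate A B (product_program n)) s)"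
    then show "k \<le> w n"
      by (rule set_run_cost_le[OF bounded inputs(3) instantiate_mvp_ops[OF inputs(1,2)]])
  qed (simp_all only: steps_linear work_linear readout_le well_formed_product_program
      result_matrix_product_program)
qed

end
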